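(* (1) If $Pr>0$, then $$\langle L_{Pr}f,f\rangle_{L^2_v}\le-\min\{Pr,1\}\,\|(I-P_c)f\|_{L^2_v}^2\qquad\text{for } f\in L^2(\mathbb{R}^3_v).$$ (2) If $Pr=0$, then $$\langle L_{Pr}f,f\rangle_{L^2_{x,v}}=-\|(I-P_{Pr})f\|_{L^2_{x,v}}^2=-\|(I-P_c-P_{nc})f\|_{L^2_{x,v}}^2\qquad\text{for } f\in L^2(\mathbb{T}^3_x\times\mathbb{R}^3_v).$$
   Context: $m(v)=(2\pi)^{-3/2}e^{-|v|^2/2}$ on $\mathbb{R}^3$. $\langle\cdot,\cdot\rangle_{L^2_v}$, $\|\cdot\|_{L^2_v}$ are the standard inner product and norm of $L^2(\mathbb{R}^3_v)$; $\langle\cdot,\cdot\rangle_{L^2_{x,v}}$, $\|\cdot\|_{L^2_{x,v}}$ those of $L^2(\mathbb{T}^3_x\times\mathbb{R}^3_v)$. Define (acting in the $v$ variable, $x$ being a parameter) $$P_cf=\Big(\int_{\mathbb{R}^3} f\sqrt m\,dv\Big)\sqrt m+\Big(\int_{\mathbb{R}^3} fv\sqrt m\,dv\Big)\cdot v\sqrt m+\Big(\int_{\mathbb{R}^3} f\tfrac{|v|^2-3}{\sqrt6}\sqrt m\,dv\Big)\tfrac{|v|^2-3}{\sqrt6}\sqrt m,$$ $$P_{nc}f=\Big(\int_{\mathbb{R}^3} f\tfrac{v(|v|^2-5)}{\sqrt{10}}\sqrt m\,dv\Big)\cdot\tfrac{v(|v|^2-5)}{\sqrt{10}}\sqrt m,$$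 $P_{Pr}f=P_cf+(1-Pr)P_{nc}f$, and $L_{Pr}f=P_{Pr}f-f$. *)

theory Defs
  imports "HOL-Analysis.Analysis"
begin

text \<open>Real-valued square-integrable functions.  Elements of \<open>L2 M\<close> are functions rather than
  classes modulo null sets; \<open>L2_inner\<close> and \<open>L2_norm\<close> depend only on the class.\<close>

definition L2 :: "'a measure \<Rightarrow> ('a \<Rightarrow> real) set" where
  "L2 M = {f. f \<in> borel_measurable M \<and> integrable M (\<lambda>z. (f z)\<^sup>2)}"

definition L2_inner :: "'a measure \<Rightarrow> ('a \<Rightarrow> real) \<Rightarrow> ('a \<Rightarrow> real) \<Rightarrow> real" where
  "L2_inner M f g = (LINT z|M. f z * g z)"

definition L2_norm :: "'a measure \<Rightarrow> ('a \<Rightarrow> real) \<Rightarrow> real" where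
  "L2_norm M f = sqrt (LINT z|M. (f z)\<^sup>2)"

text \<open>The torus is represented by the half-open unit cube, a fundamental domain of
  \<open>\<real>\<^sup>3 / \<int>\<^sup>3\<close>, with Lebesgue measure.  Only integration over the torus is
  used, so its topology plays no role.\<close>

definition torus3 :: "(real ^ 3) set" where
  "torus3 = {x. \<forall>i. 0 \<le> x $ i \<and> x $ i < 1}"

abbreviation velocity_measure :: "(real ^ 3) measure" where
  "velocity_measure \<equiv> lebesgue"

abbreviation phase_measure :: "((real ^ 3) \<times> (real ^ 3)) measure" where
  "phase_measure \<equiv> lebesgue_on (torus3 \<times> UNIV)"

definition maxwellian :: "real ^ 3 \<Rightarrow> real" where
  "maxwellian v = (2 * pi) powr (- 3 / 2) * exp (- (norm v)\<^sup>2 / 2)"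

definition P_c :: "(real ^ 3 \<Rightarrow> real) \<Rightarrow> real ^ 3 \<Rightarrow> real" where
  "P_c f v =
     (LINT w|lebesgue. f w * sqrt (maxwellian w)) * sqrt (maxwellian v)
   + ((LINT w|lebesgue. (f w * sqrt (maxwellian w)) *\<^sub>R w) \<bullet> v) * sqrt (maxwellian v)
   + (LINT w|lebesgue. f w * (((norm w)\<^sup>2 - 3) / sqrt 6) * sqrt (maxwellian w))
       * (((norm v)\<^sup>2 - 3) / sqrt 6) * sqrt (maxwellian v)"

definition P_nc :: "(real ^ 3 \<Rightarrow> real) \<Rightarrow> real ^ 3 \<Rightarrow> real" where
  "P_nc f v =
     ((LINT w|lebesgue. (f w * (((norm w)\<^sup>2 - 5) / sqrt 10) * sqrt (maxwellian w)) *\<^sub>R w)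
       \<bullet> ((((norm v)\<^sup>2 - 5) / sqrt 10) *\<^sub>R v)) * sqrt (maxwellian v)"

definition P_Pr :: "real \<Rightarrow> (real ^ 3 \<Rightarrow> real) \<Rightarrow> real ^ 3 \<Rightarrow> real" where
  "P_Pr Pr f v = P_c f v + (1 - Pr) * P_nc f v"

definition L_Pr :: "real \<Rightarrow> (real ^ 3 \<Rightarrow> real) \<Rightarrow> real ^ 3 \<Rightarrow> real" where
  "L_Pr Pr f v = P_Pr Pr f v - f v"

text \<open>An operator in \<open>v\<close> acting on functions of \<open>(x, v)\<close> with \<open>x\<close> as a parameter.\<close>

definition in_v :: "((real ^ 3 \<Rightarrow> real) \<Rightarrow> real ^ 3 \<Rightarrow> real)
    \<Rightarrow> ((real ^ 3) \<times> (real ^ 3) \<Rightarrow> real) \<Rightarrow> (real ^ 3) \<times> (real ^ 3) \<Rightarrow> real" where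
  "in_v T f = (\<lambda>(x, v). T (\<lambda>w. f (x, w)) v)"

end

theory Submission
  imports Defs "HOL-Probability.Distributions"
begin

text \<open>The eight functions \<open>\<surd>m\<close>, \<open>v\<^sub>i \<surd>m\<close>, \<open>(\<bar>v\<bar>\<^sup>2 - 3)/\<surd>6 \<surd>m\<close> and
  \<open>v\<^sub>i (\<bar>v\<bar>\<^sup>2 - 5)/\<surd>10 \<surd>m\<close> are orthonormal in \<open>L\<^sup>2\<^sub>v\<close>, so \<open>P\<^sub>c\<close> and \<open>P\<^sub>n\<^sub>c\<close> are orthogonal
  projections onto orthogonal subspaces. With \<open>S\<close> and \<open>T\<close> the squared norms of \<open>P\<^sub>c f\<close> and
  \<open>P\<^sub>n\<^sub>c f\<close> and \<open>N\<close> that of \<open>f\<close>, the form in (1) is \<open>S + (1 - Pr) T - N\<close>, and Bessel's inequality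
  \<open>S + T \<le> N\<close> gives the claim. For (2), \<open>P\<^sub>P\<^sub>r\<close> is an orthogonal projection in almost every fibre, and
  Fubini's theorem integrates the identity \<open>\<langle>P f - f, f\<rangle> = - \<parallel>f - P f\<parallel>\<^sup>2\<close> over \<open>x\<close>. Since sections of
  Lebesgue measurable functions are measurable only for almost every \<open>x\<close>, \<open>f\<close> is first replaced by an
  almost everywhere equal Borel function.\<close>

subsection \<open>Gaussian moments\<close>

text \<open>\<open>lborel\<close> is the image of a finite product of one-dimensional Lebesgue
  measures under the map from coordinates to vectors, so such integrals factor.\<close>

lemma has_bochner_integral_lborel_prod:
  fixes f :: "'a::euclidean_space \<Rightarrow> real \<Rightarrow> real"
  assumes "\<And>b. b \<in> Basis \<Longrightarrow> has_bochner_integral lborel (f b) (c b)"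
  shows "has_bochner_integral lborel (\<lambda>v. \<Prod>b\<in>Basis. f b (v \<bullet> b)) (\<Prod>b\<in>Basis. c b)"
proof -
  interpret product_sigma_finite "\<lambda>_::'a. lborel :: real measure" ..
  have int: "integrable lborel (f b)" and c: "integral\<^sup>L lborel (f b) = c b" if "b \<in> Basis" for b
    using assms[OF that] by (auto simp: has_bochner_integral_iff)
  have [measurable]: "f b \<in> borel_measurable borel" if "b \<in> Basis" for b
    using borel_measurable_integrable[OF int[OF that]] by simp
  have T: "(\<lambda>x. \<Sum>b\<in>Basis. x b *\<^sub>R b) \<in> measurable (\<Pi>\<^sub>M b\<in>(Basis::'a set). lborel) borel"
    by measurable
  have m: "(\<lambda>v::'a. \<Prod>b\<in>Basis. f b (v \<bullet> b)) \<in> borel_measurable borel"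
    by measurable
  have eq: "(\<Prod>b\<in>Basis. f b ((\<Sum>b'\<in>Basis. x b' *\<^sub>R b') \<bullet> b)) = (\<Prod>b\<in>Basis. f b (x b))" for x
    by (intro prod.cong) (auto simp: inner_sum_left inner_Basis if_distrib cong: if_cong)
  show ?thesis
    unfolding has_bochner_integral_iff lborel_eq[where 'a='a]
    using product_integrable_prod[of Basis f] product_integral_prod[of Basis f] int c
    by (simp add: integrable_distr_eq[OF T m] integral_distr[OF T m] eq)
qed

text \<open>The moments of the standard normal law; for even \<open>k\<close> the quotient is the
  double factorial of \<open>k - 1\<close>.\<close>

definition gauss_moment :: "nat \<Rightarrow> real" where
  "gauss_moment k = (if even k then fact k / (2 ^ (k div 2) * fact (k div 2)) else 0)"

lemma has_bochner_integral_std_normal_moment: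
  "has_bochner_integral lborel (\<lambda>x. std_normal_density x * x ^ k) (gauss_moment k)"
proof (cases "even k")
  case True
  then obtain j where "k = 2 * j" by blast
  then show ?thesis using std_normal_moment_even[of j] by (simp add: gauss_moment_def)
next
  case False
  then obtain j where "k = 2 * j + 1" using oddE by blast
  then show ?thesis using std_normal_moment_odd[of j] by (simp add: gauss_moment_def)
qed

section \<open>The Maxwellian as a product of one-dimensional Gaussians\<close>

lemma norm_square_3: "(norm (v :: real ^ 3))\<^sup>2 = (v $ 1)\<^sup>2 + (v $ 2)\<^sup>2 + (v $ 3)\<^sup>2"
  unfolding power2_norm_eq_inner by (simp add: inner_vec_def sum_3 power2_eq_square)

lemma maxwellian_pos: "maxwellian v > 0"
  by (simp add: maxwellian_def)

lemma sqrt_maxwellian_square: "sqrt (maxwellian v) * sqrt (maxwellian v) = maxwellian v"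
  using maxwellian_pos[of v] by simp

lemma maxwellian_measurable [measurable]: "maxwellian \<in> borel_measurable borel"
  unfolding maxwellian_def by measurable

lemma maxwellian_eq_prod:
  "maxwellian v = std_normal_density (v $ 1) * std_normal_density (v $ 2) * std_normal_density (v $ 3)"
proof -
  have "(2 * pi) powr (- 3 / 2) = 1 / (sqrt (2 * pi) * sqrt (2 * pi) * sqrt (2 * pi))"
    using powr_half_sqrt[of "2 * pi"] powr_add[of "2 * pi" 1 "1 / 2"]
    by (simp add: powr_minus_divide)
  moreover have "- (norm v)\<^sup>2 / 2 = - (v $ 1)\<^sup>2 / 2 + - (v $ 2)\<^sup>2 / 2 + - (v $ 3)\<^sup>2 / 2"
    unfolding norm_square_3 by (simp add: field_simps)
  then have "exp (- (norm v)\<^sup>2 / 2) = exp (- (v $ 1)\<^sup>2 / 2) * exp (- (v $ 2)\<^sup>2 / 2) * exp (- (v $ 3)\<^sup>2 / 2)"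
    by (simp only: exp_add)
  ultimately show ?thesis
    by (simp add: maxwellian_def std_normal_density_def)
qed

lemma prod_Basis_vec: "(\<Prod>b\<in>(Basis :: (real ^ 'n) set). g b) = (\<Prod>i\<in>UNIV. g (axis i 1))"
proof -
  have "Basis = range (\<lambda>i::'n. axis i (1::real))"
    by (auto simp: Basis_vec_def)
  moreover have "inj (\<lambda>i::'n. axis i (1::real))"
    by (auto simp: inj_on_def axis_eq_axis)
  ultimately show ?thesis
    using prod.reindex[of "\<lambda>i::'n. axis i (1::real)" UNIV g] by (simp add: o_def)
qed

lemma maxwellian_moment:
  "has_bochner_integral lborel (\<lambda>v. v $ 1 ^ i * v $ 2 ^ j * v $ 3 ^ k * maxwellian v)
     (gauss_moment i * gauss_moment j * gauss_moment k)"
proof -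
  \<comment> \<open>The product formula is indexed by \<open>Basis\<close>, so the exponents are
    attached to the basis vectors.\<close>
  define p where "p b = (if b = (axis 1 1 :: real ^ 3) then i else if b = axis 2 1 then j else k)" for b
  have p: "p (axis 1 1) = i" "p (axis 2 1) = j" "p (axis 3 1) = k"
    by (simp_all add: p_def axis_eq_axis)
  have "has_bochner_integral lborel
      (\<lambda>v::real^3. \<Prod>b\<in>Basis. std_normal_density (v \<bullet> b) * (v \<bullet> b) ^ p b)
      (\<Prod>b\<in>Basis. gauss_moment (p b))"
    using has_bochner_integral_lborel_prod[of "\<lambda>b x. std_normal_density x * x ^ p b" "\<lambda>b. gauss_moment (p b)"]
      has_bochner_integral_std_normal_moment by blast
  moreover have "(\<Prod>b\<in>Basis. std_normal_density (v \<bullet> b) * (v \<bullet> b) ^ p b)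
      = v $ 1 ^ i * v $ 2 ^ j * v $ 3 ^ k * maxwellian v" for v :: "real ^ 3"
    unfolding prod_Basis_vec UNIV_3 maxwellian_eq_prod
    by (simp add: p inner_axis)
  moreover have "(\<Prod>b\<in>(Basis :: (real ^ 3) set). gauss_moment (p b))
      = gauss_moment i * gauss_moment j * gauss_moment k"
    unfolding prod_Basis_vec UNIV_3 by (simp add: p)
  ultimately show ?thesis
    by simp
qed

text \<open>Polynomials in three variables are lists of terms (coefficient, exponents), so that
  Gaussian integrals of products are evaluated by rewriting.\<close>

type_synonym poly3 = "(real \<times> nat \<times> nat \<times> nat) list"

definition eval3 :: "poly3 \<Rightarrow> real ^ 3 \<Rightarrow> real" where
  "eval3 p v = (\<Sum>(c, i, j, k)\<leftarrow>p. c * (v $ 1 ^ i * v $ 2 ^ j * v $ 3 ^ k))"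

text \<open>Like terms are not collected, since only the value under \<open>eval3\<close> or
  \<open>gauss3\<close> matters.\<close>

definition mult3 :: "poly3 \<Rightarrow> poly3 \<Rightarrow> poly3" where
  "mult3 p q = concat (map (\<lambda>(c, i, j, k).
     map (\<lambda>(c', i', j', k'). (c * c', i + i', j + j', k + k')) q) p)"

definition gauss3 :: "poly3 \<Rightarrow> real" where
  "gauss3 p = (\<Sum>(c, i, j, k)\<leftarrow>p. c * (gauss_moment i * gauss_moment j * gauss_moment k))"

lemma eval3_simps [simp]:
  "eval3 [] v = 0"
  "eval3 ((c, i, j, k) # p) v = c * (v $ 1 ^ i * v $ 2 ^ j * v $ 3 ^ k) + eval3 p v"
  by (simp_all add: eval3_def)

lemma eval3_append: "eval3 (p @ q) v = eval3 p v + eval3 q v"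
  by (simp add: eval3_def)

lemma eval3_term_mult:
  "eval3 (map (\<lambda>(c', i', j', k'). (c * c', i + i', j + j', k + k')) q) v
    = c * (v $ 1 ^ i * v $ 2 ^ j * v $ 3 ^ k) * eval3 q v"
proof (induction q)
  case (Cons t q)
  obtain c' i' j' k' where t: "t = (c', i', j', k')" by (rule prod_cases4)
  show ?case by (simp add: t Cons power_add distrib_left)
qed simp

lemma eval3_mult3: "eval3 (mult3 p q) v = eval3 p v * eval3 q v"
proof (induction p)
  case (Cons t p)
  obtain c i j k where t: "t = (c, i, j, k)" by (rule prod_cases4)
  have "mult3 (t # p) q = map (\<lambda>(c', i', j', k'). (c * c', i + i', j + j', k + k')) q @ mult3 p q"
    by (simp add: t mult3_def)
  then show ?case by (simp add: t Cons eval3_append eval3_term_mult distrib_right)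
qed (simp add: mult3_def)

lemma has_bochner_integral_eval3:
  "has_bochner_integral lborel (\<lambda>v. eval3 p v * maxwellian v) (gauss3 p)"
proof (induction p)
  case (Cons t p)
  obtain c i j k where t: "t = (c, i, j, k)" by (rule prod_cases4)
  have eq: "eval3 (t # p) v * maxwellian v
      = c * (v $ 1 ^ i * v $ 2 ^ j * v $ 3 ^ k * maxwellian v) + eval3 p v * maxwellian v" for v
    by (simp add: t distrib_right)
  have "gauss3 (t # p) = c * (gauss_moment i * gauss_moment j * gauss_moment k) + gauss3 p"
    by (simp add: t gauss3_def)
  then show ?case
    unfolding eq
    by (simp only: has_bochner_integral_add[OF has_bochner_integral_mult_right[OF maxwellian_moment] Cons])
qed (simp add: gauss3_def has_bochner_integral_zero)

lemma eval3_measurable [measurable]: "eval3 p \<in> borel_measurable borel"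
  unfolding eval3_def by (induction p) (auto simp: case_prod_beta)

text \<open>Indices 0 to 4 span the range of \<^const>\<open>P_c\<close>, indices 5 to 7 that of \<^const>\<open>P_nc\<close>.\<close>

definition mode_poly :: "nat \<Rightarrow> poly3" where
  "mode_poly k =
     (if k = 0 then [(1, 0, 0, 0)]
      else if k = 1 then [(1, 1, 0, 0)]
      else if k = 2 then [(1, 0, 1, 0)]
      else if k = 3 then [(1, 0, 0, 1)]
      else if k = 4 then [(1, 2, 0, 0), (1, 0, 2, 0), (1, 0, 0, 2), (- 3, 0, 0, 0)]
      else if k = 5 then [(1, 3, 0, 0), (1, 1, 2, 0), (1, 1, 0, 2), (- 5, 1, 0, 0)]
      else if k = 6 then [(1, 2, 1, 0), (1, 0, 3, 0), (1, 0, 1, 2), (- 5, 0, 1, 0)]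
      else [(1, 2, 0, 1), (1, 0, 2, 1), (1, 0, 0, 3), (- 5, 0, 0, 1)])"

text \<open>Under the Gaussian weight, the squares of |v|^2 - 3 and v_i (|v|^2 - 5) integrate to 6
  and 10. Keeping the roots apart leaves integer coefficients in \<open>mode_poly\<close>.\<close>

definition mode_scale :: "nat \<Rightarrow> real" where
  "mode_scale k = (if k < 4 then 1 else if k = 4 then 1 / sqrt 6 else 1 / sqrt 10)"

definition mode :: "nat \<Rightarrow> real ^ 3 \<Rightarrow> real" where
  "mode k v = mode_scale k * eval3 (mode_poly k) v * sqrt (maxwellian v)"

lemma mode_measurable [measurable]: "mode k \<in> borel_measurable borel"
  unfolding mode_def by measurable

text \<open>Products of two mode polynomials have degree at most six, so these moments suffice.
  Addition of small exponents can also produce \<open>Suc\<close> forms.\<close>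

lemma gauss_moment_simps [simp]:
  "gauss_moment 0 = 1" "gauss_moment (Suc 0) = 0" "gauss_moment 2 = 1" "gauss_moment 3 = 0"
  "gauss_moment (Suc (Suc 0)) = 1" "gauss_moment (Suc (Suc (Suc 0))) = 0"
  "gauss_moment 4 = 3" "gauss_moment 5 = 0" "gauss_moment 6 = 15"
  by (simp_all add: gauss_moment_def fact_numeral)

lemma gauss3_mode_poly:
  assumes "k < 8" "l < 8"
  shows "mode_scale k * mode_scale l * gauss3 (mult3 (mode_poly k) (mode_poly l)) = (if k = l then 1 else 0)"
proof -
  have "k \<in> {0,1,2,3,4,5,6,7}" "l \<in> {0,1,2,3,4,5,6,7}"
    using assms by auto
  then show ?thesis
    \<comment> \<open>All 64 pairs are computed from the moments.\<close>
    by (elim insertE emptyE) (simp_all add: gauss3_def mult3_def mode_scale_def mode_poly_def)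
qed

lemma mode_orthonormal:
  assumes "k < 8" "l < 8"
  shows "has_bochner_integral lborel (\<lambda>v. mode k v * mode l v) (if k = l then 1 else 0)"
proof -
  have "mode k v * mode l v = mode_scale k * mode_scale l * (eval3 (mult3 (mode_poly k) (mode_poly l)) v * maxwellian v)"
    for v
    unfolding mode_def eval3_mult3 by (subst sqrt_maxwellian_square[symmetric]) (simp only: ac_simps)
  with has_bochner_integral_mult_right[OF has_bochner_integral_eval3[of "mult3 (mode_poly k) (mode_poly l)"],
      of "mode_scale k * mode_scale l"]
  show ?thesis by (simp only: gauss3_mode_poly[OF assms])
qed

subsection \<open>Orthonormal families in \<open>L\<^sup>2\<close>\<close>

lemma L2_mult_integrable:
  assumes "f \<in> L2 M" "g \<in> L2 M"
  shows "integrable M (\<lambda>z. f z * g z)"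
proof (rule Bochner_Integration.integrable_bound)
  show "integrable M (\<lambda>z. (f z)\<^sup>2 + (g z)\<^sup>2)" "(\<lambda>z. f z * g z) \<in> borel_measurable M"
    using assms by (auto simp: L2_def)
  have "\<bar>a * b\<bar> \<le> a\<^sup>2 + b\<^sup>2" for a b :: real
  proof -
    have "2 * \<bar>a * b\<bar> \<le> a\<^sup>2 + b\<^sup>2"
      using sum_squares_bound[of "\<bar>a\<bar>" "\<bar>b\<bar>"] by (simp add: abs_mult mult.assoc)
    then show ?thesis
      using abs_ge_zero[of "a * b"] by linarith
  qed
  then show "AE z in M. norm (f z * g z) \<le> norm ((f z)\<^sup>2 + (g z)\<^sup>2)"
    by simp
qed

lemma L2_square_integrable: "f \<in> L2 M \<Longrightarrow> integrable M (\<lambda>z. (f z)\<^sup>2)"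
  by (simp add: L2_def)

lemma L2_measurable: "f \<in> L2 M \<Longrightarrow> f \<in> borel_measurable M"
  by (simp add: L2_def)

lemma L2_cmult: "f \<in> L2 M \<Longrightarrow> (\<lambda>z. c * f z) \<in> L2 M"
  by (auto simp: L2_def power_mult_distrib)

lemma L2_add:
  assumes "f \<in> L2 M" "g \<in> L2 M"
  shows "(\<lambda>z. f z + g z) \<in> L2 M"
  using assms L2_mult_integrable[OF assms] by (auto simp: L2_def power2_sum mult.assoc)

lemma L2_diff:
  assumes "f \<in> L2 M" "g \<in> L2 M"
  shows "(\<lambda>z. f z - g z) \<in> L2 M"
  using L2_add[OF assms(1) L2_cmult[OF assms(2), of "- 1"]] by simp

lemma L2_sum:
  assumes "\<And>i. i \<in> I \<Longrightarrow> f i \<in> L2 M"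
  shows "(\<lambda>z. \<Sum>i\<in>I. f i z) \<in> L2 M"
  using assms
proof (induction I rule: infinite_finite_induct)
  case (insert i I)
  then show ?case by (simp add: L2_add)
qed (simp_all add: L2_def)

lemma L2_norm_square: "(L2_norm M f)\<^sup>2 = (LINT z|M. (f z)\<^sup>2)"
  by (simp add: L2_norm_def)

section \<open>Finite orthonormal families and Bessel's inequality\<close>

definition orthonormal :: "'a measure \<Rightarrow> 'i set \<Rightarrow> ('i \<Rightarrow> 'a \<Rightarrow> real) \<Rightarrow> bool" where
  "orthonormal M I e \<longleftrightarrow> finite I \<and> (\<forall>i\<in>I. e i \<in> L2 M)
     \<and> (\<forall>i\<in>I. \<forall>j\<in>I. L2_inner M (e i) (e j) = (if i = j then 1 else 0))"

text \<open>The free weights \<open>c\<close> let one computation serve \<open>P_Pr\<close> (weights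
  1 and 1 - Pr), \<open>P_c\<close> (weights 1 and 0) and the full projection (all weights
  1).\<close>

lemma orthonormal_combination:
  assumes e: "orthonormal M I e" and f: "f \<in> L2 M"
  defines "a \<equiv> \<lambda>i. L2_inner M f (e i)"
  defines "p \<equiv> \<lambda>c z. \<Sum>i\<in>I. c i * a i * e i z"
  shows "p c \<in> L2 M"
    and "(LINT z|M. p c z * f z) = (\<Sum>i\<in>I. c i * (a i)\<^sup>2)"
    and "(LINT z|M. (p c z)\<^sup>2) = (\<Sum>i\<in>I. (c i)\<^sup>2 * (a i)\<^sup>2)"
proof -
  have I: "finite I" and e2: "\<And>i. i \<in> I \<Longrightarrow> e i \<in> L2 M"
    and on: "\<And>i j. i \<in> I \<Longrightarrow> j \<in> I \<Longrightarrow> (LINT z|M. e i z * e j z) = (if i = j then 1 else 0)"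
    using e by (auto simp: orthonormal_def L2_inner_def)
  show p: "p c \<in> L2 M"
    unfolding p_def by (intro L2_sum L2_cmult e2)
  \<comment> \<open>The second factor stays general because \<open>f\<close>, the \<open>e i\<close>
    and \<open>p c\<close> itself are all substituted for it.\<close>
  have pg: "(LINT z|M. p c z * g z) = (\<Sum>i\<in>I. c i * a i * (LINT z|M. e i z * g z))" if "g \<in> L2 M" for g
  proof -
    have "(LINT z|M. p c z * g z) = (LINT z|M. (\<Sum>i\<in>I. c i * a i * (e i z * g z)))"
      by (simp add: p_def sum_distrib_right mult.assoc)
    also have "\<dots> = (\<Sum>i\<in>I. (LINT z|M. c i * a i * (e i z * g z)))"
      by (intro Bochner_Integration.integral_sum integrable_mult_right L2_mult_integrable e2 that)
    finally show ?thesis by simp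
  qed
  show "(LINT z|M. p c z * f z) = (\<Sum>i\<in>I. c i * (a i)\<^sup>2)"
    unfolding pg[OF f] by (simp add: a_def L2_inner_def power2_eq_square mult_ac)
  have pe: "(LINT z|M. e i z * p c z) = c i * a i" if "i \<in> I" for i
    using pg[OF e2[OF that]] on that I
    by (simp add: mult.commute[of "e i _"] if_distrib cong: if_cong sum.cong)
  show "(LINT z|M. (p c z)\<^sup>2) = (\<Sum>i\<in>I. (c i)\<^sup>2 * (a i)\<^sup>2)"
    unfolding power2_eq_square pg[OF p] by (simp add: pe power2_eq_square mult_ac cong: sum.cong)
qed

text \<open>If all weights are 1, the two sums coincide and the right-hand sides are negatives of
  each other: the identity for an orthogonal projection.\<close>

lemma orthonormal_combination_diff:
  assumes e: "orthonormal M I e" and f: "f \<in> L2 M"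
  defines "a \<equiv> \<lambda>i. L2_inner M f (e i)"
  defines "p \<equiv> \<lambda>c z. \<Sum>i\<in>I. c i * a i * e i z"
  shows "(LINT z|M. (p c z - f z) * f z) = (\<Sum>i\<in>I. c i * (a i)\<^sup>2) - (LINT z|M. (f z)\<^sup>2)"
    and "(LINT z|M. (f z - p c z)\<^sup>2)
      = (LINT z|M. (f z)\<^sup>2) - 2 * (\<Sum>i\<in>I. c i * (a i)\<^sup>2) + (\<Sum>i\<in>I. (c i)\<^sup>2 * (a i)\<^sup>2)"
proof -
  have comb: "p c \<in> L2 M" "(LINT z|M. p c z * f z) = (\<Sum>i\<in>I. c i * (a i)\<^sup>2)"
      "(LINT z|M. (p c z)\<^sup>2) = (\<Sum>i\<in>I. (c i)\<^sup>2 * (a i)\<^sup>2)"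
    unfolding p_def a_def using orthonormal_combination[OF e f] by blast+
  note int = L2_mult_integrable[OF comb(1) f] L2_square_integrable[OF f] L2_square_integrable[OF comb(1)]
  have "(LINT z|M. (p c z - f z) * f z) = (LINT z|M. p c z * f z - (f z)\<^sup>2)"
    by (simp add: power2_eq_square left_diff_distrib)
  also have "\<dots> = (LINT z|M. p c z * f z) - (LINT z|M. (f z)\<^sup>2)"
    by (rule Bochner_Integration.integral_diff[OF int(1,2)])
  finally show "(LINT z|M. (p c z - f z) * f z) = (\<Sum>i\<in>I. c i * (a i)\<^sup>2) - (LINT z|M. (f z)\<^sup>2)"
    using comb(2) by simp
  have "(LINT z|M. (f z - p c z)\<^sup>2) = (LINT z|M. (f z)\<^sup>2 - 2 * (p c z * f z) + (p c z)\<^sup>2)"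
    by (simp add: power2_eq_square algebra_simps)
  also have "\<dots> = (LINT z|M. (f z)\<^sup>2) - 2 * (LINT z|M. p c z * f z) + (LINT z|M. (p c z)\<^sup>2)"
    using int by simp
  finally show "(LINT z|M. (f z - p c z)\<^sup>2)
      = (LINT z|M. (f z)\<^sup>2) - 2 * (\<Sum>i\<in>I. c i * (a i)\<^sup>2) + (\<Sum>i\<in>I. (c i)\<^sup>2 * (a i)\<^sup>2)"
    using comb(2,3) by simp
qed

text \<open>With all weights 1, the squared distance from \<open>f\<close> to its projection is the
  difference of the two sides.\<close>

lemma bessel_inequality:
  assumes "orthonormal M I e" "f \<in> L2 M"
  shows "(\<Sum>i\<in>I. (L2_inner M f (e i))\<^sup>2) \<le> (LINT z|M. (f z)\<^sup>2)"
proof -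
  have "0 \<le> (LINT z|M. (f z - (\<Sum>i\<in>I. 1 * L2_inner M f (e i) * e i z))\<^sup>2)"
    by (rule Bochner_Integration.integral_nonneg) simp
  then show ?thesis
    unfolding orthonormal_combination_diff(2)[OF assms] by simp
qed

section \<open>Projection in every fibre and Fubini's theorem\<close>

lemma (in pair_sigma_finite) section_projection:
  fixes g :: "'a \<times> 'b \<Rightarrow> real"
  assumes e: "orthonormal M2 I e" and g: "g \<in> L2 (M1 \<Otimes>\<^sub>M M2)"
  defines "p \<equiv> \<lambda>z. \<Sum>i\<in>I. L2_inner M2 (\<lambda>w. g (fst z, w)) (e i) * e i (snd z)"
  shows "p \<in> L2 (M1 \<Otimes>\<^sub>M M2)"
    and "L2_inner (M1 \<Otimes>\<^sub>M M2) (\<lambda>z. p z - g z) g = - (LINT z|(M1 \<Otimes>\<^sub>M M2). (g z - p z)\<^sup>2)"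
proof -
  have em [measurable]: "e i \<in> borel_measurable M2" if "i \<in> I" for i
    using e that by (auto simp: orthonormal_def L2_def)
  have gm [measurable]: "g \<in> borel_measurable (M1 \<Otimes>\<^sub>M M2)"
    using g by (rule L2_measurable)
  have pm [measurable]: "p \<in> borel_measurable (M1 \<Otimes>\<^sub>M M2)"
    unfolding p_def L2_inner_def by measurable
  have g2: "integrable (M1 \<Otimes>\<^sub>M M2) (\<lambda>z. (g z)\<^sup>2)"
    using g by (rule L2_square_integrable)
  have sec: "AE x in M1. (\<lambda>w. g (x, w)) \<in> L2 M2"
    using AE_integrable_fst'[OF g2] AE_space
    by eventually_elim (simp add: L2_def)
  \<comment> \<open>The factor 1 exhibits each section of \<open>p\<close> as a weighted combination
    with constant weight 1.\<close>
  have p1: "p (x, w) = (\<Sum>i\<in>I. 1 * L2_inner M2 (\<lambda>w. g (x, w)) (e i) * e i w)" for x w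
    by (simp add: p_def)
  have p2: "integrable (M1 \<Otimes>\<^sub>M M2) (\<lambda>z. (p z)\<^sup>2)"
  proof (rule Fubini_integrable)
    show "integrable M1 (\<lambda>x. LINT y|M2. norm ((p (x, y))\<^sup>2))"
    \<comment> \<open>Bessel's inequality in almost every fibre bounds the norm of the section of
      \<open>p\<close> by that of \<open>g\<close>, which is integrable in \<open>x\<close>.\<close>
    proof (rule Bochner_Integration.integrable_bound[OF integrable_fst'[OF g2]])
      show "AE x in M1. norm (LINT y|M2. norm ((p (x, y))\<^sup>2)) \<le> norm (LINT y|M2. (g (x, y))\<^sup>2)"
        using sec
      proof eventually_elim
        case (elim x)
        have "(LINT y|M2. (p (x, y))\<^sup>2) \<le> (LINT y|M2. (g (x, y))\<^sup>2)"
          using orthonormal_combination(3)[OF e elim, of "\<lambda>_. 1"] bessel_inequality[OF e elim]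
          by (simp add: p1)
        then show ?case by simp
      qed
    qed measurable
    show "AE x in M1. integrable M2 (\<lambda>y. (p (x, y))\<^sup>2)"
      using sec
    proof eventually_elim
      case (elim x)
      show ?case
        using orthonormal_combination(1)[OF e elim, of "\<lambda>_. 1"] unfolding p1 by (rule L2_square_integrable)
    qed
  qed measurable
  with pm show p: "p \<in> L2 (M1 \<Otimes>\<^sub>M M2)"
    by (simp add: L2_def)
  have i1: "integrable (M1 \<Otimes>\<^sub>M M2) (\<lambda>z. (p z - g z) * g z)"
    by (intro L2_mult_integrable L2_diff p g)
  have i2: "integrable (M1 \<Otimes>\<^sub>M M2) (\<lambda>z. (g z - p z)\<^sup>2)"
    by (intro L2_square_integrable L2_diff p g)
  have "(LINT z|(M1 \<Otimes>\<^sub>M M2). (p z - g z) * g z) = (LINT x|M1. LINT y|M2. (p (x, y) - g (x, y)) * g (x, y))"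
    using integral_fst'[OF i1] by simp
  also have "\<dots> = (LINT x|M1. - (LINT y|M2. (g (x, y) - p (x, y))\<^sup>2))"
  proof (rule integral_cong_AE)
    show "AE x in M1. (LINT y|M2. (p (x, y) - g (x, y)) * g (x, y)) = - (LINT y|M2. (g (x, y) - p (x, y))\<^sup>2)"
      using sec
    proof eventually_elim
      case (elim x)
      show ?case
        using orthonormal_combination_diff[OF e elim, of "\<lambda>_. 1"] by (simp add: p1)
    qed
  qed measurable
  also have "\<dots> = - (LINT z|(M1 \<Otimes>\<^sub>M M2). (g z - p z)\<^sup>2)"
    using integral_fst'[OF i2] by simp
  finally show "L2_inner (M1 \<Otimes>\<^sub>M M2) (\<lambda>z. p z - g z) g = - (LINT z|(M1 \<Otimes>\<^sub>M M2). (g z - p z)\<^sup>2)"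
    by (simp add: L2_inner_def)
qed

subsection \<open>The operators as orthogonal projections\<close>

lemma L2_borel_lebesgue:
  assumes "f \<in> borel_measurable borel"
  shows "f \<in> L2 lebesgue \<longleftrightarrow> f \<in> L2 lborel"
  using assms by (simp add: L2_def integrable_completion measurable_completion)

lemma orthonormal_mode_lborel: "orthonormal lborel {..<8} mode"
proof -
  have "mode k \<in> L2 lborel" if "k < 8" for k
    using mode_orthonormal[OF that that] by (auto simp: L2_def power2_eq_square has_bochner_integral_iff)
  then show ?thesis
    using mode_orthonormal by (auto simp: orthonormal_def L2_inner_def has_bochner_integral_iff)
qed

lemma orthonormal_mode: "orthonormal lebesgue {..<8} mode"
  using orthonormal_mode_lborel
  by (simp add: orthonormal_def L2_inner_def L2_borel_lebesgue integral_completion)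

section \<open>Expansion of the operators in the eight modes\<close>

lemma mode_simps:
  "mode 0 v = sqrt (maxwellian v)"
  "mode (Suc 0) v = v $ 1 * sqrt (maxwellian v)"
  "mode 2 v = v $ 2 * sqrt (maxwellian v)"
  "mode 3 v = v $ 3 * sqrt (maxwellian v)"
  "mode 4 v = ((norm v)\<^sup>2 - 3) / sqrt 6 * sqrt (maxwellian v)"
  "mode 5 v = v $ 1 * (((norm v)\<^sup>2 - 5) / sqrt 10) * sqrt (maxwellian v)"
  "mode 6 v = v $ 2 * (((norm v)\<^sup>2 - 5) / sqrt 10) * sqrt (maxwellian v)"
  "mode 7 v = v $ 3 * (((norm v)\<^sup>2 - 5) / sqrt 10) * sqrt (maxwellian v)"
  unfolding norm_square_3
  by (simp_all add: mode_def mode_poly_def mode_scale_def power2_eq_square power3_eq_cube field_simps)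

text \<open>Turns the vector-valued integrals in \<open>P_c\<close> and \<open>P_nc\<close> into
  scalar coefficients, by linearity over the coordinate axes.\<close>

lemma integral_vec3:
  fixes F :: "'a \<Rightarrow> real ^ 3"
  assumes "\<And>i. integrable M (\<lambda>w. F w $ i)"
  shows "(LINT w|M. F w) = (\<chi> i. LINT w|M. F w $ i)"
proof -
  have "F w = (\<Sum>i\<in>UNIV. (F w $ i) *\<^sub>R axis i 1)" for w
    using basis_expansion[of "F w"] by (simp add: scalar_mult_eq_scaleR)
  then have "(LINT w|M. F w) = (LINT w|M. (\<Sum>i\<in>UNIV. (F w $ i) *\<^sub>R axis i 1))"
    by simp
  also have "\<dots> = (\<Sum>i\<in>UNIV. (LINT w|M. F w $ i) *\<^sub>R axis i 1)"
    using assms by simp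
  also have "\<dots> = (\<chi> i. LINT w|M. F w $ i)"
    using basis_expansion[of "\<chi> i. LINT w|M. F w $ i"] by (simp add: scalar_mult_eq_scaleR)
  finally show ?thesis .
qed

lemma P_c_expansion:
  assumes "f \<in> L2 lebesgue"
  shows "P_c f v = (\<Sum>k<5. L2_inner lebesgue f (mode k) * mode k v)"
proof -
  have int: "integrable lebesgue (\<lambda>w. f w * mode k w)" if "k < 8" for k
    using assms orthonormal_mode that by (intro L2_mult_integrable) (auto simp: orthonormal_def)
  have "(LINT w|lebesgue. (f w * sqrt (maxwellian w)) *\<^sub>R w) = (\<chi> i. LINT w|lebesgue. ((f w * sqrt (maxwellian w)) *\<^sub>R w) $ i)"
  proof (rule integral_vec3)
    show "integrable lebesgue (\<lambda>w. ((f w * sqrt (maxwellian w)) *\<^sub>R w) $ i)" for i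
      using exhaust_3[of i] int[of 1] int[of 2] int[of 3] by (auto simp: mode_simps mult_ac)
  qed
  then show ?thesis
    unfolding P_c_def
    by (simp add: lessThan_nat_numeral lessThan_Suc L2_inner_def mode_simps inner_vec_def sum_3 algebra_simps)
qed

lemma P_nc_expansion:
  assumes "f \<in> L2 lebesgue"
  shows "P_nc f v = (\<Sum>k\<in>{5..<8}. L2_inner lebesgue f (mode k) * mode k v)"
proof -
  have int: "integrable lebesgue (\<lambda>w. f w * mode k w)" if "k < 8" for k
    using assms orthonormal_mode that by (intro L2_mult_integrable) (auto simp: orthonormal_def)
  let ?F = "\<lambda>w. (f w * (((norm w)\<^sup>2 - 5) / sqrt 10) * sqrt (maxwellian w)) *\<^sub>R w"
  have "(LINT w|lebesgue. ?F w) = (\<chi> i. LINT w|lebesgue. ?F w $ i)"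
  proof (rule integral_vec3)
    show "integrable lebesgue (\<lambda>w. ?F w $ i)" for i
      using exhaust_3[of i] int[of 5] int[of 6] int[of 7] by (auto simp: mode_simps mult_ac)
  qed
  moreover have "{5..<8} = {5, 6, 7 :: nat}" by auto
  ultimately show ?thesis
    unfolding P_nc_def
    by (simp add: L2_inner_def mode_simps inner_vec_def sum_3 algebra_simps)
qed

lemma coercivity_Pr_pos:
  assumes Pr: "Pr > 0" and f: "f \<in> L2 lebesgue"
  shows "L2_inner lebesgue (L_Pr Pr f) f \<le> - min Pr 1 * (L2_norm lebesgue (\<lambda>v. f v - P_c f v))\<^sup>2"
proof -
  define a where "a k = L2_inner lebesgue f (mode k)" for k
  define S where "S = (\<Sum>k<5. (a k)\<^sup>2)"
  define T where "T = (\<Sum>k\<in>{5..<8}. (a k)\<^sup>2)"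
  define N where "N = (LINT v|lebesgue. (f v)\<^sup>2)"
  \<comment> \<open>The weights \<open>w\<close> and \<open>u\<close> present \<open>P_Pr\<close>
    and \<open>P_c\<close> as combinations of the same eight modes.\<close>
  define w where "w k = (if k < 5 then 1 else 1 - Pr)" for k :: nat
  define u where "u k = (if k < 5 then 1 else 0 :: real)" for k :: nat
  have split: "(\<Sum>k<8. h k) = (\<Sum>k<5. h k) + (\<Sum>k\<in>{5..<8}. h k)" for h :: "nat \<Rightarrow> real"
    using sum.atLeastLessThan_concat[of 0 5 8 h] by (simp add: atLeast0LessThan)
  have wS: "(\<Sum>k<8. w k * (a k)\<^sup>2) = S + (1 - Pr) * T"
    by (simp add: split w_def S_def T_def sum_distrib_left)
  have uS: "(\<Sum>k<8. u k * (a k)\<^sup>2) = S" "(\<Sum>k<8. (u k)\<^sup>2 * (a k)\<^sup>2) = S"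
    by (simp_all add: split u_def S_def)
  have P: "P_Pr Pr f v = (\<Sum>k<8. w k * a k * mode k v)" for v
    by (simp add: P_Pr_def P_c_expansion[OF f] P_nc_expansion[OF f] a_def split w_def sum_distrib_left mult.assoc)
  have Pc: "P_c f v = (\<Sum>k<8. u k * a k * mode k v)" for v
    by (simp add: P_c_expansion[OF f] a_def split u_def)
  have inner: "L2_inner lebesgue (L_Pr Pr f) f = S + (1 - Pr) * T - N"
    using orthonormal_combination_diff(1)[OF orthonormal_mode f, of w]
    by (simp add: L2_inner_def[of _ "L_Pr Pr f"] L_Pr_def P N_def wS flip: a_def)
  have norm: "(L2_norm lebesgue (\<lambda>v. f v - P_c f v))\<^sup>2 = N - S"
    using orthonormal_combination_diff(2)[OF orthonormal_mode f, of u]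
    by (simp add: L2_norm_square Pc N_def uS flip: a_def)
  have "S + T \<le> N"
    using bessel_inequality[OF orthonormal_mode f] by (simp add: split S_def T_def N_def flip: a_def)
  moreover have "T \<ge> 0"
    by (simp add: T_def sum_nonneg)
  moreover have "Pr < 1 \<Longrightarrow> (1 - Pr) * T \<le> (1 - Pr) * (N - S)"
    using calculation by (intro mult_left_mono) auto
  moreover have "1 \<le> Pr \<Longrightarrow> (1 - Pr) * T \<le> 0"
    using calculation by (simp add: mult_nonpos_nonneg)
  ultimately show ?thesis
    unfolding inner norm by (cases "Pr < 1") (auto simp: min_def algebra_simps)
qed

section \<open>Lebesgue measurable functions and Borel representatives\<close>

text \<open>The preimages of a set under \<open>f\<close> and \<open>g\<close> differ by a null set,
  and completeness makes such a set measurable.\<close>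

lemma (in complete_measure) measurable_cong_AE:
  assumes g: "g \<in> M \<rightarrow>\<^sub>M N" and eq: "AE x in M. f x = g x"
    and f: "f \<in> space M \<rightarrow> space N"
  shows "f \<in> M \<rightarrow>\<^sub>M N"
proof (rule measurableI)
  show "f x \<in> space N" if "x \<in> space M" for x
    using f that by blast
  fix A assume "A \<in> sets N"
  then have gA: "g -` A \<inter> space M \<in> sets M"
    using g by (rule measurable_sets[rotated])
  have "AE x in M. x \<in> g -` A \<inter> space M \<longleftrightarrow> x \<in> f -` A \<inter> space M"
    using eq by eventually_elim simp
  then show "f -` A \<inter> space M \<in> sets M"
    by (rule in_sets_AE[OF _ gA]) simp
qed

text \<open>Moves integrals to \<open>lborel\<close>, which on a product space is the product of the
  two \<open>lborel\<close> measures, so that Fubini's theorem applies. Measurability of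
  \<open>f\<close> is a conclusion, obtained from completeness.\<close>

lemma integral_lebesgue_eq_AE:
  fixes f g :: "'a::euclidean_space \<Rightarrow> real"
  assumes g: "g \<in> borel_measurable borel" and eq: "AE z in lborel. f z = g z"
  shows "f \<in> borel_measurable lebesgue" "integrable lebesgue f \<longleftrightarrow> integrable lborel g"
    and "integral\<^sup>L lebesgue f = integral\<^sup>L lborel g"
proof -
  have g': "g \<in> borel_measurable lebesgue" "g \<in> borel_measurable lborel"
    using g by (auto intro: measurable_completion)
  have eq': "AE z in lebesgue. f z = g z"
    using eq by (simp add: AE_completion_iff)
  show f: "f \<in> borel_measurable lebesgue"
    using completion.measurable_cong_AE[OF g'(1) eq'] by simp
  show "integrable lebesgue f \<longleftrightarrow> integrable lborel g"
    using integrable_cong_AE[OF f g'(1) eq'] integrable_completion[OF g'(2)] by simp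
  show "integral\<^sup>L lebesgue f = integral\<^sup>L lborel g"
    using integral_cong_AE[OF f g'(1) eq'] integral_completion[OF g'(2)] by simp
qed

lemma AE_fst_lborel:
  assumes "AE x in lborel. Q x"
  shows "AE z in lborel :: ('a::euclidean_space \<times> 'b::euclidean_space) measure. Q (fst z)"
proof -
  \<comment> \<open>\<open>Q\<close> may fail on a set that is not Borel; a Borel null set
    \<open>N\<close> containing it gives a measurable null cylinder.\<close>
  obtain N where N: "{x. \<not> Q x} \<subseteq> N" "emeasure lborel N = 0" "N \<in> sets borel"
    using assms by (auto elim: AE_E)
  have [measurable]: "N \<in> sets borel" by (rule N(3))
  have "AE x in lborel. x \<notin> N"
    using N by (intro AE_not_in) auto
  moreover have "{z \<in> space (lborel \<Otimes>\<^sub>M (lborel :: 'b measure)). fst z \<notin> N}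
      \<in> sets (lborel \<Otimes>\<^sub>M (lborel :: 'b measure))"
    by measurable
  ultimately have "AE z in lborel \<Otimes>\<^sub>M (lborel :: 'b measure). fst z \<notin> N"
    by (intro lborel_pair.AE_pair_measure) auto
  then have "AE z in lborel :: ('a \<times> 'b) measure. fst z \<notin> N"
    unfolding lborel_prod .
  then show ?thesis
    by (rule AE_mp) (use N(1) in auto)
qed

lemma torus3_measurable [measurable]: "torus3 \<in> sets borel"
  unfolding torus3_def by measurable

lemma phase_measure_projection:
  assumes f: "f \<in> L2 phase_measure"
  shows "L2_inner phase_measure (\<lambda>z. in_v (P_Pr 0) f z - f z) f
    = - (LINT z|phase_measure. (f z - in_v (P_Pr 0) f z)\<^sup>2)"
proof -
  let ?T = "torus3 \<times> UNIV :: ((real ^ 3) \<times> (real ^ 3)) set"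
  have T_eq: "z \<in> ?T \<longleftrightarrow> fst z \<in> torus3" for z
    by (cases z) auto
  have "Measurable.pred (borel :: ((real ^ 3) \<times> (real ^ 3)) measure) (\<lambda>z. fst z \<in> torus3)"
    unfolding borel_prod[symmetric] by measurable
  then have T [measurable]: "?T \<in> sets borel"
    by (simp add: pred_def T_eq[symmetric])
  then have TL: "?T \<in> sets lebesgue" by simp
  define F where "F z = (if z \<in> ?T then f z else 0)" for z
  have "F \<in> borel_measurable lebesgue"
    unfolding F_def using f by (simp add: borel_measurable_if[OF TL] L2_def)
  then obtain g0 where g0: "g0 \<in> borel_measurable lborel" "AE z in lborel. F z = g0 z"
    using completion_ex_borel_measurable_real by blast
  \<comment> \<open>The indicator makes \<open>g\<close> vanish everywhere off the domain, not just
    almost everywhere, so its sections over \<open>x\<close> outside \<open>torus3\<close> are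
    identically zero.\<close>
  define g where "g z = indicator ?T z * g0 z" for z
  have g [measurable]: "g \<in> borel_measurable borel"
    using g0(1) unfolding g_def by measurable
  have fg: "AE z in lborel. indicator ?T z * f z = g z"
    using g0(2) by eventually_elim (auto simp: F_def g_def indicator_def)
  \<comment> \<open>Only \<open>h'\<close> has to be measurable. Hence the measurability of
    \<open>in_v (P_Pr 0) f\<close> follows from its agreement with \<open>p\<close> and needs no
    separate argument.\<close>
  have phase: "integrable phase_measure h \<longleftrightarrow> integrable lborel h'"
      "integral\<^sup>L phase_measure h = integral\<^sup>L lborel h'"
    if "h' \<in> borel_measurable borel" "AE z in lborel. indicator ?T z * h z = h' z" for h h' :: "(real ^ 3) \<times> (real ^ 3) \<Rightarrow> real"
    using integral_lebesgue_eq_AE[OF that] TL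
    by (simp_all add: integrable_restrict_space integral_restrict_space)
  have "integrable lborel (\<lambda>z. (g z)\<^sup>2)"
  proof (subst phase(1)[symmetric])
    show "AE z in lborel. indicator ?T z * (f z)\<^sup>2 = (g z)\<^sup>2"
      using fg
    proof eventually_elim
      case (elim z)
      then show ?case by (cases "z \<in> ?T") auto
    qed
  qed (use f in \<open>auto simp: L2_def\<close>)
  then have gL2: "g \<in> L2 lborel"
    by (simp add: L2_def)
  define p where "p z = (\<Sum>k<8. L2_inner lborel (\<lambda>w. g (fst z, w)) (mode k) * mode k (snd z))" for z
  have p: "p \<in> L2 lborel" "L2_inner lborel (\<lambda>z. p z - g z) g = - (LINT z|lborel. (g z - p z)\<^sup>2)"
    using lborel_pair.section_projection[OF orthonormal_mode_lborel, unfolded lborel_prod, OF gL2]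
    unfolding p_def by blast+
  have pm [measurable]: "p \<in> borel_measurable borel"
    using p(1) by (simp add: L2_def)
  have "AE x in lborel. AE w in lborel. indicator ?T (x, w) * f (x, w) = g (x, w)"
    using lborel_pair.AE_pair[of "\<lambda>z. indicator ?T z * f z = g z"] fg unfolding lborel_prod by blast
  moreover have "AE x in lborel. integrable lborel (\<lambda>w. (g (x, w))\<^sup>2)"
    using lborel_pair.AE_integrable_fst'[of "\<lambda>z. (g z)\<^sup>2"] L2_square_integrable[OF gL2]
    unfolding lborel_prod by blast
  \<comment> \<open>For almost every \<open>x\<close> equality holds for every \<open>v\<close>,
    because the projection sees the section of \<open>f\<close> only through integrals, which ignore
    null sets. The exceptional set thus depends on \<open>x\<close> alone.\<close>
  ultimately have "AE x in lborel. \<forall>v. indicator ?T (x, v) * in_v (P_Pr 0) f (x, v) = p (x, v)"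
  proof eventually_elim
    case (elim x)
    have gx [measurable]: "(\<lambda>w. g (x, w)) \<in> borel_measurable borel"
      by (rule measurable_compose[OF _ g]) measurable
    show ?case
    proof (cases "x \<in> torus3")
      case True
      then have eq: "AE w in lborel. f (x, w) = g (x, w)"
        using elim(1) by simp
      then have sq: "AE w in lborel. (f (x, w))\<^sup>2 = (g (x, w))\<^sup>2"
        by eventually_elim simp
      \<comment> \<open>The expansions of \<open>P_c\<close> and \<open>P_nc\<close> require a
        square-integrable section; this one inherits the property from the section of
        \<open>g\<close>.\<close>
      have fx: "(\<lambda>w. f (x, w)) \<in> L2 lebesgue"
        unfolding L2_def
        using integral_lebesgue_eq_AE(1)[OF gx eq] integral_lebesgue_eq_AE(2)[OF _ sq] elim(2)
        by simp
      have inner: "L2_inner lebesgue (\<lambda>w. f (x, w)) (mode k) = L2_inner lborel (\<lambda>w. g (x, w)) (mode k)" for k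
        unfolding L2_inner_def
      proof (rule integral_lebesgue_eq_AE(3))
        show "AE w in lborel. f (x, w) * mode k w = g (x, w) * mode k w"
          using eq by eventually_elim simp
      qed measurable
      have "in_v (P_Pr 0) f (x, v) = (\<Sum>k<8. L2_inner lborel (\<lambda>w. g (x, w)) (mode k) * mode k v)" for v
        using sum.atLeastLessThan_concat[of 0 5 8 "\<lambda>k. L2_inner lborel (\<lambda>w. g (x, w)) (mode k) * mode k v"]
        by (simp add: in_v_def P_Pr_def P_c_expansion[OF fx] P_nc_expansion[OF fx] inner atLeast0LessThan)
      with True show ?thesis
        by (simp add: p_def)
    next
      case False
      then have "g (x, w) = 0" for w
        by (simp add: g_def)
      with False show ?thesis
        by (simp add: p_def L2_inner_def)
    qed
  qed
  then have "AE z in lborel. \<forall>v. indicator ?T (fst z, v) * in_v (P_Pr 0) f (fst z, v) = p (fst z, v)"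
    by (rule AE_fst_lborel)
  then have fp: "AE z in lborel. indicator ?T z * in_v (P_Pr 0) f z = p z"
    by eventually_elim (metis prod.collapse)
  have "L2_inner phase_measure (\<lambda>z. in_v (P_Pr 0) f z - f z) f = L2_inner lborel (\<lambda>z. p z - g z) g"
    unfolding L2_inner_def
  proof (rule phase(2))
    show "AE z in lborel. indicator ?T z * ((in_v (P_Pr 0) f z - f z) * f z) = (p z - g z) * g z"
      using fg fp
    proof eventually_elim
      case (elim z)
      then show ?case by (cases "z \<in> ?T") auto
    qed
  qed measurable
  moreover have "(LINT z|phase_measure. (f z - in_v (P_Pr 0) f z)\<^sup>2) = (LINT z|lborel. (g z - p z)\<^sup>2)"
  proof (rule phase(2))
    show "AE z in lborel. indicator ?T z * (f z - in_v (P_Pr 0) f z)\<^sup>2 = (g z - p z)\<^sup>2"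
      using fg fp
    proof eventually_elim
      case (elim z)
      then show ?case by (cases "z \<in> ?T") auto
    qed
  qed measurable
  ultimately show ?thesis
    using p(2) by simp
qed

theorem proposition2p2:
  fixes Pr :: real
  shows "(Pr > 0 \<longrightarrow>
      (\<forall>f \<in> L2 velocity_measure.
         L2_inner velocity_measure (L_Pr Pr f) f
           \<le> - min Pr 1 * (L2_norm velocity_measure (\<lambda>v. f v - P_c f v))\<^sup>2))
    \<and> (Pr = 0 \<longrightarrow>
      (\<forall>f \<in> L2 phase_measure.
         L2_inner phase_measure (in_v (L_Pr Pr) f) f
           = - (L2_norm phase_measure (\<lambda>z. f z - in_v (P_Pr Pr) f z))\<^sup>2
       \<and> - (L2_norm phase_measure (\<lambda>z. f z - in_v (P_Pr Pr) f z))\<^sup>2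
           = - (L2_norm phase_measure (\<lambda>z. f z - in_v P_c f z - in_v P_nc f z))\<^sup>2))"
proof (intro conjI impI ballI)
  fix f assume "Pr > 0" "f \<in> L2 velocity_measure"
  then show "L2_inner velocity_measure (L_Pr Pr f) f
      \<le> - min Pr 1 * (L2_norm velocity_measure (\<lambda>v. f v - P_c f v))\<^sup>2"
    by (rule coercivity_Pr_pos)
next
  fix f assume Pr: "Pr = 0" and f: "f \<in> L2 phase_measure"
  have "in_v (L_Pr Pr) f = (\<lambda>z. in_v (P_Pr 0) f z - f z)"
    by (auto simp: in_v_def L_Pr_def Pr)
  then show "L2_inner phase_measure (in_v (L_Pr Pr) f) f
      = - (L2_norm phase_measure (\<lambda>z. f z - in_v (P_Pr Pr) f z))\<^sup>2"
    using phase_measure_projection[OF f] by (simp only: L2_norm_square Pr)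
  \<comment> \<open>At \<open>Pr = 0\<close> the weight of \<open>P_nc\<close> is 1, so the two
    functions agree pointwise.\<close>
  have "(\<lambda>z. f z - in_v (P_Pr Pr) f z) = (\<lambda>z. f z - in_v P_c f z - in_v P_nc f z)"
    by (auto simp: in_v_def P_Pr_def Pr)
  then show "- (L2_norm phase_measure (\<lambda>z. f z - in_v (P_Pr Pr) f z))\<^sup>2
      = - (L2_norm phase_measure (\<lambda>z. f z - in_v P_c f z - in_v P_nc f z))\<^sup>2"
    by (rule arg_cong)
qed

end
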